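(* Let $a<b<c$ be real numbers, let $\psi_1,\psi_2,f:\mathbb{R}\to\mathbb{R}$ and $q\in C([a,c],\mathbb{R})$ satisfy the standing hypotheses (i)–(v) listed in the context, and suppose that the equation $$(\psi_{2}((\psi_{1}(u'))'))' + q(x)f(u) = 0$$ has a nontrivial solution $u(x)$ on $[a,c]$ satisfying $$u(a)=u(b)=u(c)=0,\qquad u(x)\neq 0 \text{ for } x\in(a,b)\cup(b,c).$$ Let $\Phi(s) = \dfrac{f(s)}{\psi_{2}(\psi_{1}(s))}$. Then either $$\max_{\xi\in [a,b]}\left\{\int_{a}^{\xi}q_{-}(x)\Phi(u(x))\,dx + \int_{\xi}^{b}q_{+}(x)\Phi(u(x))\,dx\right\} > \psi_{2}\left(\frac{\frac{2}{b-a}}{\psi_{1}\left(\frac{b-a}{2}\right)}\right),$$ or $$\max_{\xi\in [b,c]}\left\{\int_{b}^{\xi}q_{-}(x)\Phi(u(x))\,dx + \int_{\xi}^{c}q_{+}(x)\Phi(u(x))\,dx\right\} > \psi_{2}\left(\frac{\frac{2}{c-b}}{\psi_{1}\left(\frac{c-b}{2}\right)}\right)$$ (at least one of the two holds). As a result, $$\max_{\xi\in [a,c]}\left\{\int_{a}^{\xi}q_{-}(x)\Phi(u(x))\,dx + \int_{\xi}^{c}q_{+}(x)\Phi(u(x))\,dx\right\} > \psi_{2}\left(\frac{\frac{2}{c-a}}{\psi_{1}\left(\frac{c-a}{2}\right)}\right).$$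
   Context: Standing hypotheses: (i) $\psi_1$ and $\psi_2$ are odd and (strictly) increasing functions $\mathbb{R}\to\mathbb{R}$; (ii) $\psi_1$ is sub-multiplicative on $[0,\infty)$, i.e. $\psi_1(xy)\le\psi_1(x)\psi_1(y)$ for all $x,y\ge 0$, and $1/\psi_1(s)$ is a convex function for $s>0$; (iii) $\psi_2$ is super-multiplicative on $[0,\infty)$, i.e. $\psi_2(xy)\ge\psi_2(x)\psi_2(y)$ for all $x,y\ge 0$; (iv) $q\in C([a,c],\mathbb{R})$, and $q$ may change sign; (v) $f:\mathbb{R}\to\mathbb{R}$ is odd, continuous and satisfies $sf(s)>0$ for $s\ne 0$. Notation: $q_+(x)=\max\{q(x),0\}$ and $q_-(x)=\max\{-q(x),0\}$. A solution is a real function $u$ such that $u$, $\psi_1(u')$ and $\psi_2((\psi_1(u'))')$ are continuously differentiable and the equation holds pointwise; nontrivial means not identically zero. The function $\Phi(s)$ is defined (and positive) for $s\neq 0$; integrals involving $\Phi(u(x))$ are taken over the points where $u(x)\ne 0$, and are allowed to take the value $+\infty$. *)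

theory Defs
  imports "HOL-Analysis.Analysis"
begin

text \<open>The derivative is taken within S, hence one-sided at the end points of a compact interval.\<close>

definition C1_with_deriv_on :: "(real \<Rightarrow> real) \<Rightarrow> (real \<Rightarrow> real) \<Rightarrow> real set \<Rightarrow> bool" where
  "C1_with_deriv_on g g' S \<longleftrightarrow>
     (\<forall>x\<in>S. (g has_real_derivative g' x) (at x within S)) \<and> continuous_on S g'"

text \<open>Here \<open>u'\<close> is the derivative of \<open>u\<close>, \<open>w\<close> that of \<open>\<psi>1(u')\<close> and \<open>z\<close> that of
  \<open>\<psi>2((\<psi>1(u'))')\<close>; on a nondegenerate interval they are uniquely determined by \<open>u\<close>.\<close>

definition is_solution_on ::
  "(real \<Rightarrow> real) \<Rightarrow> (real \<Rightarrow> real) \<Rightarrow> (real \<Rightarrow> real) \<Rightarrow> (real \<Rightarrow> real) \<Rightarrow> real set \<Rightarrow> (real \<Rightarrow> real) \<Rightarrow> bool"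
where
  "is_solution_on \<psi>1 \<psi>2 q f S u \<longleftrightarrow>
     (\<exists>u' w z.
        C1_with_deriv_on u u' S \<and>
        C1_with_deriv_on (\<lambda>x. \<psi>1 (u' x)) w S \<and>
        C1_with_deriv_on (\<lambda>x. \<psi>2 (w x)) z S \<and>
        (\<forall>x\<in>S. z x + q x * f (u x) = 0))"

definition pos_part :: "(real \<Rightarrow> real) \<Rightarrow> real \<Rightarrow> real" where
  "pos_part q x = max (q x) 0"

definition neg_part :: "(real \<Rightarrow> real) \<Rightarrow> real \<Rightarrow> real" where
  "neg_part q x = max (- q x) 0"

definition Phi :: "(real \<Rightarrow> real) \<Rightarrow> (real \<Rightarrow> real) \<Rightarrow> (real \<Rightarrow> real) \<Rightarrow> real \<Rightarrow> real" where
  "Phi \<psi>1 \<psi>2 f s = f s / \<psi>2 (\<psi>1 s)"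

text \<open>The integrands are nonnegative and the integrals may diverge, so they are Lebesgue integrals
  with values in \<open>[0, \<infinity>]\<close>, taken over the points where \<open>u\<close> does not vanish.\<close>

definition split_integral ::
  "(real \<Rightarrow> real) \<Rightarrow> (real \<Rightarrow> real) \<Rightarrow> (real \<Rightarrow> real) \<Rightarrow> real \<Rightarrow> real \<Rightarrow> real \<Rightarrow> ennreal"
where
  "split_integral q \<Phi> u l r \<xi> =
     (\<integral>\<^sup>+x\<in>{x\<in>{l..\<xi>}. u x \<noteq> 0}. ennreal (neg_part q x * \<Phi> (u x)) \<partial>lborel) +
     (\<integral>\<^sup>+x\<in>{x\<in>{\<xi>..r}. u x \<noteq> 0}. ennreal (pos_part q x * \<Phi> (u x)) \<partial>lborel)"

text \<open>\<open>M\<close> is the attained maximum of \<open>g\<close> on the set \<open>S\<close>, which need not be finite.\<close>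

definition is_maximum_on :: "('a \<Rightarrow> 'b::order) \<Rightarrow> 'a set \<Rightarrow> 'b \<Rightarrow> bool" where
  "is_maximum_on g S M \<longleftrightarrow> M \<in> g ` S \<and> (\<forall>x\<in>S. g x \<le> M)"

end

theory Submission
  imports Defs
begin

text \<open>
  Since \<open>u\<close> vanishes at \<open>a\<close>, \<open>b\<close> and \<open>c\<close>, Rolle's theorem yields a zero of \<open>u'\<close> in each of
  \<open>(a, b)\<close> and \<open>(b, c)\<close>, and applied once more, to \<open>\<psi>1(u')\<close>, a zero \<open>d\<close> of \<open>w = (\<psi>1(u'))'\<close>
  between the two. Let \<open>[l, r]\<close> be whichever of \<open>[a, b]\<close> and \<open>[b, c]\<close> contains \<open>d\<close>. The split
  integral over \<open>[l, r]\<close>, taken at the point \<open>\<xi> = d\<close>, already exceeds the threshold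
  of that interval (\<open>lyapunov\<close>).

  To see this, take \<open>u > 0\<close> on \<open>(l, r)\<close>, which costs nothing because \<open>\<psi>1\<close>, \<open>\<psi>2\<close> and \<open>f\<close> are odd. Let
  \<open>m = u(x0)\<close> be the maximum of \<open>u\<close> on \<open>[l, r]\<close>, let \<open>W\<close> be the maximum of \<open>- w\<close> there, and put
  \<open>h = (r - l) / 2\<close>. Two estimates are combined.

  \<^item> Between \<open>x0\<close> and the nearer end point, at distance \<open>k \<le> h\<close>, the slope of \<open>u\<close> has absolute
    value \<open>m / k\<close> somewhere. As \<open>\<psi>1(u')\<close> vanishes at \<open>x0\<close> and
    changes at a rate at most \<open>W\<close> in the relevant direction, sub-multiplicativity of \<open>\<psi>1\<close> gives
    \<open>\<psi>1(m) < h \<psi>1(h) W\<close> (\<open>height_bound\<close>).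

  \<^item> Integrating the equation from \<open>d\<close>, where \<open>\<psi>2(w)\<close> vanishes, to a point where \<open>- w = W\<close> bounds
    \<open>\<psi>2(W)\<close> by an integral of \<open>q\<^sub>- f(u)\<close> to the left of \<open>d\<close> or of \<open>q\<^sub>+ f(u)\<close> to its right.
    Because \<open>f(u) \<le> \<psi>2(\<psi>1(m)) \<Phi>(u)\<close>, the split integral at \<open>d\<close> is at least
    \<open>\<psi>2(W) / \<psi>2(\<psi>1(m))\<close> (\<open>split_integral_lower_bound\<close>).

  By super-multiplicativity of \<open>\<psi>2\<close> that quotient is at least \<open>\<psi>2(W / \<psi>1(m))\<close>, and the first
  estimate makes this larger than \<open>\<psi>2((1 / h) / \<psi>1(h))\<close>. On the whole of \<open>[a, c]\<close> the split
  integral at \<open>d\<close> can only grow, while the threshold decreases with the length of the interval.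
  The maxima are attained because a split integral is either continuous or infinite at an
  end point (\<open>sum_of_nn_integrals_attains_maximum\<close>).
\<close>

section \<open>Continuously differentiable functions on an interval\<close>

lemma C1_with_deriv_on_mvt:
  assumes "C1_with_deriv_on g g' S" "s < t" "{s..t} \<subseteq> S"
  obtains \<xi> where "s < \<xi>" "\<xi> < t" "g t - g s = (t - s) * g' \<xi>"
proof -
  have "(g has_derivative (\<lambda>h. g' x * h)) (at x within {s..t})" if "s \<le> x" "x \<le> t" for x
    using assms that unfolding C1_with_deriv_on_def has_field_derivative_def
    by (meson atLeastAtMost_iff has_derivative_subset subsetD)
  from mvt_simple[OF assms(2) this] show thesis
    using that by (auto simp: mult.commute)
qed

lemma C1_with_deriv_on_subset:
  assumes "C1_with_deriv_on g g' S" "T \<subseteq> S"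
  shows "C1_with_deriv_on g g' T"
  using assms unfolding C1_with_deriv_on_def
  by (meson DERIV_subset continuous_on_subset subsetD)

lemma C1_with_deriv_on_uminus:
  assumes "C1_with_deriv_on g g' S"
  shows "C1_with_deriv_on (\<lambda>x. - g x) (\<lambda>x. - g' x) S"
  using assms unfolding C1_with_deriv_on_def
  by (auto intro: DERIV_minus continuous_on_minus)

lemma C1_with_deriv_on_continuous:
  assumes "C1_with_deriv_on g g' S"
  shows "continuous_on S g"
  using assms unfolding C1_with_deriv_on_def
  by (meson DERIV_continuous continuous_on_eq_continuous_within)

lemma C1_with_deriv_on_has_integral:
  assumes "C1_with_deriv_on g g' S" "s \<le> t" "{s..t} \<subseteq> S"
  shows "(g' has_integral (g t - g s)) {s..t}"
  using assms(2)
proof (rule fundamental_theorem_of_calculus)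
  fix x assume "x \<in> {s..t}"
  with assms show "(g has_vector_derivative g' x) (at x within {s..t})"
    unfolding C1_with_deriv_on_def has_real_derivative_iff_has_vector_derivative
    by (meson has_vector_derivative_within_subset subsetD)
qed

section \<open>Integrals with values in the extended nonnegative reals\<close>

text \<open>Bridges the fundamental theorem of calculus, a statement on signed Henstock-Kurzweil
  integrals, and the Lebesgue integrals over a larger domain \<open>T\<close>. The lower integral is monotone
  for arbitrary functions, so \<open>k\<close> may be any majorant of \<open>g\<close>.\<close>

lemma has_integral_le_nn_integral:
  fixes g k :: "real \<Rightarrow> real"
  assumes g: "(g has_integral I) {s..t}" and "continuous_on {s..t} g"
    and T: "{s..t} \<subseteq> T"
    and le: "\<And>x. x \<in> {s..t} \<Longrightarrow> g x \<le> k x"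
  shows "ennreal I \<le> (\<integral>\<^sup>+x\<in>T. ennreal (k x) \<partial>lborel)"
proof -
  let ?m = "\<lambda>x. max (g x) 0"
  have cont: "continuous_on {s..t} ?m"
    using assms(2) by (intro continuous_intros)
  then obtain J where J: "(?m has_integral J) {s..t}"
    using integrable_continuous_interval integrable_on_def by blast
  have "I \<le> J"
    using g J by (rule has_integral_le) auto
  have si: "set_integrable lborel {s..t} ?m"
    using cont by (rule borel_integrable_atLeastAtMost')
  have "J = (LINT x:{s..t}|lborel. ?m x)"
    using set_borel_integral_eq_integral(2)[OF si] J by (simp add: integral_unique)
  then have "ennreal J = (\<integral>\<^sup>+x. ennreal (indicator {s..t} x * ?m x) \<partial>lborel)"
    using si unfolding set_lebesgue_integral_def set_integrable_def
    by (subst nn_integral_eq_integral) auto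
  also have "\<dots> \<le> (\<integral>\<^sup>+x\<in>T. ennreal (k x) \<partial>lborel)"
  proof (rule nn_integral_mono)
    fix x
    have "ennreal (?m x) \<le> ennreal (k x)" if "x \<in> {s..t}"
      using le[OF that] by (cases "0 \<le> g x") (auto simp: ennreal_leI max_def)
    then show "ennreal (indicator {s..t} x * ?m x) \<le> ennreal (k x) * indicator T x"
      using T by (auto simp: indicator_def)
  qed
  finally show ?thesis
    using \<open>I \<le> J\<close> by (meson ennreal_leI order.trans)
qed

lemma nn_integral_Icc_eq_integral:
  fixes n :: "real \<Rightarrow> real"
  assumes n: "n \<in> borel_measurable (restrict_space borel {l..r})" "\<And>x. 0 \<le> n x"
    and fin: "(\<integral>\<^sup>+x\<in>{l..r}. ennreal (n x) \<partial>lborel) \<noteq> \<infinity>"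
    and "{s..t} \<subseteq> {l..r}"
  shows "n integrable_on {s..t}"
    and "(\<integral>\<^sup>+x\<in>{s..t}. ennreal (n x) \<partial>lborel) = ennreal (integral {s..t} n)"
proof -
  have "(\<lambda>x. indicator {l..r} x *\<^sub>R n x) \<in> borel_measurable lborel"
    using n(1) by (subst (asm) borel_measurable_restrict_space_iff) auto
  moreover have "(\<integral>\<^sup>+x. ennreal (norm (indicator {l..r} x *\<^sub>R n x)) \<partial>lborel)
      = (\<integral>\<^sup>+x\<in>{l..r}. ennreal (n x) \<partial>lborel)"
    using n(2) by (intro nn_integral_cong) (auto simp: indicator_def)
  ultimately have "set_integrable lborel {l..r} n"
    using fin unfolding set_integrable_def
    by (auto intro!: integrableI_bounded simp: top.not_eq_extremum)
  then have si': "set_integrable lborel {s..t} n"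
    by (rule set_integrable_subset) (use assms in auto)
  then show "n integrable_on {s..t}"
    by (rule set_borel_integral_eq_integral)
  have "(\<integral>\<^sup>+x\<in>{s..t}. ennreal (n x) \<partial>lborel)
      = (\<integral>\<^sup>+x. ennreal (indicator {s..t} x * n x) \<partial>lborel)"
    by (intro nn_integral_cong) (auto simp: indicator_def)
  also have "\<dots> = ennreal (LINT x:{s..t}|lborel. n x)"
    using si' n(2) unfolding set_lebesgue_integral_def set_integrable_def
    by (subst nn_integral_eq_integral) auto
  also have "\<dots> = ennreal (integral {s..t} n)"
    using set_borel_integral_eq_integral(2)[OF si'] by simp
  finally show "(\<integral>\<^sup>+x\<in>{s..t}. ennreal (n x) \<partial>lborel) = ennreal (integral {s..t} n)" .
qed

text \<open>If either integral over all of \<open>{l..r}\<close> diverges, the value at the corresponding end point is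
  infinite and hence maximal. Otherwise both summands are continuous indefinite
  integrals on a compact interval.\<close>

lemma sum_of_nn_integrals_attains_maximum:
  fixes n p :: "real \<Rightarrow> real"
  assumes "l \<le> r"
    and n: "n \<in> borel_measurable (restrict_space borel {l..r})" "\<And>x. 0 \<le> n x"
    and p: "p \<in> borel_measurable (restrict_space borel {l..r})" "\<And>x. 0 \<le> p x"
  shows "\<exists>M. is_maximum_on (\<lambda>\<xi>. (\<integral>\<^sup>+x\<in>{l..\<xi>}. ennreal (n x) \<partial>lborel) +
                               (\<integral>\<^sup>+x\<in>{\<xi>..r}. ennreal (p x) \<partial>lborel)) {l..r} M"
    (is "\<exists>M. is_maximum_on ?G _ M")
proof (cases "?G l = \<infinity> \<or> ?G r = \<infinity>")
  case True
  then show ?thesis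
    using \<open>l \<le> r\<close> unfolding is_maximum_on_def
    by (intro exI[of _ \<infinity>]) (auto simp: image_iff intro: bexI[of _ l] bexI[of _ r])
next
  case False
  then have fin: "(\<integral>\<^sup>+x\<in>{l..r}. ennreal (n x) \<partial>lborel) \<noteq> \<infinity>"
      "(\<integral>\<^sup>+x\<in>{l..r}. ennreal (p x) \<partial>lborel) \<noteq> \<infinity>"
    by auto
  let ?g = "\<lambda>\<xi>. integral {l..\<xi>} n + integral {\<xi>..r} p"
  have G: "?G \<xi> = ennreal (?g \<xi>)" if "\<xi> \<in> {l..r}" for \<xi>
  proof -
    have "?G \<xi> = ennreal (integral {l..\<xi>} n) + ennreal (integral {\<xi>..r} p)"
      using nn_integral_Icc_eq_integral(2)[OF n fin(1), of l \<xi>]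
        nn_integral_Icc_eq_integral(2)[OF p fin(2), of \<xi> r] that by simp
    also have "\<dots> = ennreal (?g \<xi>)"
      using nn_integral_Icc_eq_integral(1)[OF n fin(1), of l \<xi>]
        nn_integral_Icc_eq_integral(1)[OF p fin(2), of \<xi> r] that n(2) p(2)
      by (intro ennreal_plus[symmetric] Henstock_Kurzweil_Integration.integral_nonneg) auto
    finally show ?thesis .
  qed
  have "n integrable_on {l..r}" "p integrable_on {l..r}"
    using nn_integral_Icc_eq_integral(1)[OF n fin(1), of l r]
      nn_integral_Icc_eq_integral(1)[OF p fin(2), of l r] by auto
  then have "continuous_on {l..r} ?g"
    by (intro continuous_on_add indefinite_integral_continuous_1 indefinite_integral_continuous_1')
  then obtain \<xi> where "\<xi> \<in> {l..r}" "\<And>x. x \<in> {l..r} \<Longrightarrow> ?g x \<le> ?g \<xi>"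
    using continuous_attains_sup[of "{l..r}" ?g] \<open>l \<le> r\<close> by auto
  then show ?thesis
    unfolding is_maximum_on_def
    by (intro exI[of _ "?G \<xi>"]) (auto simp: G intro!: ennreal_leI)
qed

section \<open>Odd increasing functions and the weight \<open>\<Phi>\<close>\<close>

locale odd_increasing =
  fixes \<psi> :: "real \<Rightarrow> real"
  assumes odd: "\<psi> (- x) = - \<psi> x"
    and increasing: "strict_mono \<psi>"
begin

lemma at_0 [simp]: "\<psi> 0 = 0"
  using odd[of 0] by simp

lemma pos_iff [simp]: "0 < \<psi> x \<longleftrightarrow> 0 < x"
  using strict_mono_less[OF increasing, of 0 x] by simp

lemma nonneg_iff [simp]: "0 \<le> \<psi> x \<longleftrightarrow> 0 \<le> x"
  using strict_mono_less_eq[OF increasing, of 0 x] by simp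

lemma eq_0_iff [simp]: "\<psi> x = 0 \<longleftrightarrow> x = 0"
  using strict_mono_eq[OF increasing, of x 0] by simp

end

locale half_linear_data =
  psi1: odd_increasing \<psi>1 + psi2: odd_increasing \<psi>2 for \<psi>1 \<psi>2 :: "real \<Rightarrow> real" +
  fixes f :: "real \<Rightarrow> real"
  assumes submult: "0 \<le> x \<Longrightarrow> 0 \<le> y \<Longrightarrow> \<psi>1 (x * y) \<le> \<psi>1 x * \<psi>1 y"
    and supermult: "0 \<le> x \<Longrightarrow> 0 \<le> y \<Longrightarrow> \<psi>2 (x * y) \<ge> \<psi>2 x * \<psi>2 y"
    and f_odd: "f (- s) = - f s"
    and f_cont: "continuous_on UNIV f"
    and f_sign: "s \<noteq> 0 \<Longrightarrow> s * f s > 0"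
begin

abbreviation "\<Phi> \<equiv> Phi \<psi>1 \<psi>2 f"

lemma f_0 [simp]: "f 0 = 0"
  using f_odd[of 0] by simp

lemma Phi_0 [simp]: "\<Phi> 0 = 0"
  by (simp add: Phi_def)

lemma Phi_minus [simp]: "\<Phi> (- s) = \<Phi> s"
  by (simp add: Phi_def f_odd psi1.odd psi2.odd)

lemma Phi_nonneg: "0 \<le> \<Phi> s"
proof -
  have pos: "0 \<le> \<Phi> s" if "0 < s" for s
  proof -
    have "0 < f s"
      using f_sign[of s] that by (simp add: zero_less_mult_iff)
    then show ?thesis
      using that by (auto simp: Phi_def)
  qed
  show ?thesis
    using pos[of s] pos[of "- s"] by (cases s "0 :: real" rule: linorder_cases) auto
qed

lemma Phi_measurable [measurable]: "\<Phi> \<in> borel_measurable borel"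
proof -
  have [measurable]: "f \<in> borel_measurable borel"
    using f_cont by (rule borel_measurable_continuous_onI)
  have [measurable]: "\<psi>1 \<in> borel_measurable borel" "\<psi>2 \<in> borel_measurable borel"
    using psi1.increasing psi2.increasing
    by (auto intro!: borel_measurable_mono strict_mono_mono)
  show ?thesis
    unfolding Phi_def by measurable
qed

text \<open>A point where \<open>u\<close> vanishes contributes nothing to either integrand, as \<open>\<Phi> 0 = 0 / 0 = 0\<close>.\<close>

lemma split_integral_eq:
  "split_integral q \<Phi> u l r \<xi> =
     (\<integral>\<^sup>+x\<in>{l..\<xi>}. ennreal (neg_part q x * \<Phi> (u x)) \<partial>lborel) +
     (\<integral>\<^sup>+x\<in>{\<xi>..r}. ennreal (pos_part q x * \<Phi> (u x)) \<partial>lborel)"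
  unfolding split_integral_def
  by (intro arg_cong2[where f = "(+)"] nn_integral_cong) (auto simp: indicator_def)

lemma split_integral_minus:
  "split_integral q \<Phi> (\<lambda>x. - u x) l r \<xi> = split_integral q \<Phi> u l r \<xi>"
  by (simp add: split_integral_eq)

lemma split_integral_mono:
  assumes "l' \<le> l" "r \<le> r'"
  shows "split_integral q \<Phi> u l r \<xi> \<le> split_integral q \<Phi> u l' r' \<xi>"
  unfolding split_integral_eq using assms
  by (intro add_mono nn_integral_mono) (auto simp: indicator_def)

lemma split_integral_attains_maximum:
  assumes "l \<le> r" and [measurable]: "continuous_on {l..r} q" "continuous_on {l..r} u"
  shows "\<exists>M. is_maximum_on (split_integral q \<Phi> u l r) {l..r} M"
proof -
  have [measurable]: "q \<in> borel_measurable (restrict_space borel {l..r})"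
      "u \<in> borel_measurable (restrict_space borel {l..r})"
    using assms by (auto intro: borel_measurable_continuous_on_restrict)
  show ?thesis
    unfolding split_integral_eq [abs_def]
    by (rule sum_of_nn_integrals_attains_maximum[OF \<open>l \<le> r\<close>])
       (auto simp: neg_part_def pos_part_def Phi_nonneg)
qed

lemma threshold_antimono:
  assumes "0 < s" "s \<le> t"
  shows "\<psi>2 ((2 / t) / \<psi>1 (t / 2)) \<le> \<psi>2 ((2 / s) / \<psi>1 (s / 2))"
proof -
  have "\<psi>1 (s / 2) \<le> \<psi>1 (t / 2)"
    using assms strict_mono_less_eq[OF psi1.increasing] by simp
  then have "(2 / t) / \<psi>1 (t / 2) \<le> (2 / s) / \<psi>1 (s / 2)"
    using assms by (intro frac_le) auto
  then show ?thesis
    using strict_mono_less_eq[OF psi2.increasing] by simp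
qed

lemma f_le_Phi:
  assumes "0 \<le> s" "s \<le> m"
  shows "f s \<le> \<psi>2 (\<psi>1 m) * \<Phi> s"
proof (cases "s = 0")
  case False
  have "f s = \<psi>2 (\<psi>1 s) * \<Phi> s"
    using False by (simp add: Phi_def)
  also have "\<dots> \<le> \<psi>2 (\<psi>1 m) * \<Phi> s"
    using assms Phi_nonneg strict_mono_less_eq[OF psi1.increasing] strict_mono_less_eq[OF psi2.increasing]
    by (intro mult_right_mono) auto
  finally show ?thesis .
qed simp

section \<open>The two estimates on an interval between consecutive zeros\<close>

text \<open>The mean value theorem for \<open>u\<close> on \<open>[l, x0]\<close> produces a point \<open>\<xi>\<close> of slope \<open>u(x0) / (x0 - l)\<close>, and
  for \<open>\<psi>1(u')\<close> on \<open>[\<xi>, x0]\<close> the bound \<open>\<psi>1(u'(\<xi>)) \<le> (x0 - \<xi>) W\<close>; the same works on \<open>[x0, r]\<close>.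
  Using the side on which \<open>x0\<close> is nearer to the end point replaces its length by
  \<open>(r - l) / 2\<close>. The inequality is strict because \<open>\<xi>\<close> lies strictly inside.\<close>

lemma height_bound:
  assumes u: "C1_with_deriv_on u u' {l..r}"
    and w: "C1_with_deriv_on (\<lambda>x. \<psi>1 (u' x)) w {l..r}"
    and "u l = 0" "u r = 0"
    and x0: "l < x0" "x0 < r" "u' x0 = 0" and m: "0 < u x0"
    and W: "\<And>x. x \<in> {l..r} \<Longrightarrow> - w x \<le> W"
  shows "0 < W" "\<psi>1 (u x0) < (r - l) / 2 * \<psi>1 ((r - l) / 2) * W"
proof -
  obtain \<xi> where \<xi>: "l < \<xi>" "\<xi> < x0" "u x0 - u l = (x0 - l) * u' \<xi>"
    using C1_with_deriv_on_mvt[OF u, of l x0] x0 by auto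
  obtain \<eta> where \<eta>: "\<xi> < \<eta>" "\<eta> < x0" "\<psi>1 (u' x0) - \<psi>1 (u' \<xi>) = (x0 - \<xi>) * w \<eta>"
    using C1_with_deriv_on_mvt[OF w, of \<xi> x0] \<xi> x0 by auto
  have u\<xi>: "0 < u' \<xi>"
    using \<xi> m \<open>u l = 0\<close> by (simp add: zero_less_mult_iff)
  have eq: "\<psi>1 (u' \<xi>) = (x0 - \<xi>) * (- w \<eta>)"
    using \<eta> x0 by simp
  then have "0 < - w \<eta>"
    using u\<xi> psi1.pos_iff[of "u' \<xi>"] \<xi> by (simp add: mult_less_0_iff)
  also have W\<eta>: "- w \<eta> \<le> W"
    using W \<eta> \<xi> x0 by simp
  finally show "0 < W" .
  obtain \<xi>' where \<xi>': "x0 < \<xi>'" "\<xi>' < r" "u r - u x0 = (r - x0) * u' \<xi>'"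
    using C1_with_deriv_on_mvt[OF u, of x0 r] x0 by auto
  obtain \<eta>' where \<eta>': "x0 < \<eta>'" "\<eta>' < \<xi>'" "\<psi>1 (u' \<xi>') - \<psi>1 (u' x0) = (\<xi>' - x0) * w \<eta>'"
    using C1_with_deriv_on_mvt[OF w, of x0 \<xi>'] \<xi>' x0 by auto
  have um: "u x0 = (r - x0) * (- u' \<xi>')"
    using \<xi>' \<open>u r = 0\<close> by simp
  then have u\<xi>': "0 < - u' \<xi>'"
    using m x0 by (metis diff_gt_0_iff_gt zero_less_mult_pos)
  have eq': "\<psi>1 (- u' \<xi>') = (\<xi>' - x0) * (- w \<eta>')"
    using \<eta>' x0 by (simp add: psi1.odd)
  have W\<eta>': "- w \<eta>' \<le> W"
    using W \<eta>' \<xi>' x0 by simp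
  \<comment> \<open>Both sides at once: \<open>k\<close> is the distance from \<open>x0\<close> to the end point, \<open>v\<close> the absolute slope at
     the intermediate point, \<open>t\<close> the distance of that point from \<open>x0\<close>.\<close>
  have *: "\<psi>1 (u x0) < (r - l) / 2 * \<psi>1 ((r - l) / 2) * W"
    if "u x0 = k * v" "\<psi>1 v = t * W'" "0 < k" "k \<le> (r - l) / 2" "0 < t" "t < k" "0 < v" "W' \<le> W"
    for k v t W'
  proof -
    have "\<psi>1 (u x0) \<le> \<psi>1 k * \<psi>1 v"
      using submult[of k v] that by simp
    also have "\<dots> \<le> \<psi>1 k * (t * W)"
      using that by (intro mult_left_mono) auto
    also have "\<dots> < \<psi>1 k * (k * W)"
      using that \<open>0 < W\<close> by (intro mult_strict_left_mono mult_strict_right_mono) auto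
    also have "\<dots> \<le> \<psi>1 ((r - l) / 2) * ((r - l) / 2 * W)"
      using that \<open>0 < W\<close> strict_mono_less_eq[OF psi1.increasing]
      by (intro mult_mono mult_right_mono) auto
    finally show ?thesis
      by (simp add: algebra_simps)
  qed
  show "\<psi>1 (u x0) < (r - l) / 2 * \<psi>1 ((r - l) / 2) * W"
  proof (cases "x0 - l \<le> r - x0")
    case True
    show ?thesis
      by (rule *[where k = "x0 - l", OF _ eq]) (use True \<xi> x0 u\<xi> W\<eta> \<open>u l = 0\<close> in auto)
  next
    case False
    show ?thesis
      by (rule *[OF um eq']) (use False \<xi>' x0 u\<xi>' W\<eta>' in auto)
  qed
qed

text \<open>As \<open>\<psi>2(w)\<close> vanishes at \<open>d\<close> and has derivative \<open>- q f(u)\<close>, the value \<open>- \<psi>2(w(y))\<close> is the integral of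
  \<open>- q f(u)\<close> over \<open>[y, d]\<close> or of \<open>q f(u)\<close> over \<open>[d, y]\<close>. This is why \<open>q\<^sub>-\<close> appears
  to the left of the splitting point and \<open>q\<^sub>+\<close> to its right. The constant \<open>\<psi>2(\<psi>1(m))\<close> is divided
  out before the passage to extended reals, where the integral may be infinite.\<close>

lemma split_integral_lower_bound:
  assumes z: "C1_with_deriv_on (\<lambda>x. \<psi>2 (w x)) z {l..r}"
    and eqn: "\<And>x. x \<in> {l..r} \<Longrightarrow> z x + q x * f (u x) = 0"
    and d: "d \<in> {l..r}" "w d = 0" and y: "y \<in> {l..r}"
    and u: "\<And>x. x \<in> {l..r} \<Longrightarrow> 0 \<le> u x" "\<And>x. x \<in> {l..r} \<Longrightarrow> u x \<le> m" and "0 < m"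
  shows "ennreal (- \<psi>2 (w y) / \<psi>2 (\<psi>1 m)) \<le> split_integral q \<Phi> u l r d"
proof -
  let ?C = "\<psi>2 (\<psi>1 m)"
  have C: "0 < ?C"
    using \<open>0 < m\<close> by simp
  have cont: "continuous_on {l..r} (\<lambda>x. z x / ?C)" "continuous_on {l..r} (\<lambda>x. - z x / ?C)"
    using z C unfolding C1_with_deriv_on_def by (auto intro!: continuous_intros)
  \<comment> \<open>\<open>p\<close> will be \<open>- q x\<close> to the left of \<open>d\<close> and \<open>q x\<close> to its right.\<close>
  have bound: "p * f (u x) / ?C \<le> max p 0 * \<Phi> (u x)" if "x \<in> {l..r}" for x p
  proof -
    have "0 \<le> f (u x)"
      using f_sign[of "u x"] u(1)[OF that] by (cases "u x = 0") (auto simp: zero_less_mult_iff)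
    then have "p * f (u x) \<le> max p 0 * f (u x)"
      by (intro mult_right_mono) auto
    also have "\<dots> \<le> max p 0 * (?C * \<Phi> (u x))"
      using f_le_Phi u that by (intro mult_left_mono) auto
    finally show ?thesis
      using C by (simp add: field_simps)
  qed
  show ?thesis
  proof (cases "y \<le> d")
    case True
    have "(z has_integral - \<psi>2 (w y)) {y..d}"
      using C1_with_deriv_on_has_integral[OF z True] d y by simp
    then have "((\<lambda>x. z x / ?C) has_integral - \<psi>2 (w y) / ?C) {y..d}"
      by (rule has_integral_divide)
    then have "ennreal (- \<psi>2 (w y) / ?C) \<le> (\<integral>\<^sup>+x\<in>{l..d}. ennreal (neg_part q x * \<Phi> (u x)) \<partial>lborel)"
    proof (rule has_integral_le_nn_integral)
      fix x assume "x \<in> {y..d}"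
      then have "x \<in> {l..r}"
        using y d by simp
      moreover from this have "z x = - q x * f (u x)"
        using eqn[of x] by simp
      ultimately show "z x / ?C \<le> neg_part q x * \<Phi> (u x)"
        using bound[of x "- q x"] by (simp add: neg_part_def)
    qed (use y d cont in \<open>auto intro: continuous_on_subset\<close>)
    then show ?thesis
      unfolding split_integral_eq by (rule order.trans) simp
  next
    case False
    then have "d \<le> y"
      by simp
    then have "(z has_integral \<psi>2 (w y)) {d..y}"
      using C1_with_deriv_on_has_integral[OF z \<open>d \<le> y\<close>] d y by simp
    then have "((\<lambda>x. - z x / ?C) has_integral - \<psi>2 (w y) / ?C) {d..y}"
      by (intro has_integral_divide has_integral_neg)
    then have "ennreal (- \<psi>2 (w y) / ?C) \<le> (\<integral>\<^sup>+x\<in>{d..r}. ennreal (pos_part q x * \<Phi> (u x)) \<partial>lborel)"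
    proof (rule has_integral_le_nn_integral)
      fix x assume "x \<in> {d..y}"
      then have "x \<in> {l..r}"
        using y d by simp
      moreover from this have "- z x = q x * f (u x)"
        using eqn[of x] by simp
      ultimately show "- z x / ?C \<le> pos_part q x * \<Phi> (u x)"
        using bound[of x "q x"] by (simp add: pos_part_def)
    qed (use y d cont in \<open>auto intro: continuous_on_subset\<close>)
    then show ?thesis
      unfolding split_integral_eq by (rule order.trans) simp
  qed
qed

section \<open>The Lyapunov-type inequality\<close>

lemma lyapunov_positive:
  assumes "l < r"
    and u: "C1_with_deriv_on u u' {l..r}"
    and w: "C1_with_deriv_on (\<lambda>x. \<psi>1 (u' x)) w {l..r}"
    and z: "C1_with_deriv_on (\<lambda>x. \<psi>2 (w x)) z {l..r}"
    and eqn: "\<And>x. x \<in> {l..r} \<Longrightarrow> z x + q x * f (u x) = 0"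
    and ends: "u l = 0" "u r = 0"
    and pos: "\<And>x. x \<in> {l<..<r} \<Longrightarrow> 0 < u x"
    and d: "d \<in> {l..r}" "w d = 0"
  shows "ennreal (\<psi>2 ((2 / (r - l)) / \<psi>1 ((r - l) / 2))) < split_integral q \<Phi> u l r d"
proof -
  obtain x0 where x0: "x0 \<in> {l..r}" "\<And>x. x \<in> {l..r} \<Longrightarrow> u x \<le> u x0"
    using continuous_attains_sup[of "{l..r}" u] C1_with_deriv_on_continuous[OF u] \<open>l < r\<close> by auto
  have m: "0 < u x0"
    using pos[of "(l + r) / 2"] x0(2)[of "(l + r) / 2"] \<open>l < r\<close> by simp
  then have in_x0: "l < x0" "x0 < r"
    using x0(1) ends by (auto simp: less_le)
  have "(u has_real_derivative u' x0) (at x0)"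
    using u x0(1) in_x0 unfolding C1_with_deriv_on_def
    by (metis at_within_Icc_at)
  then have u'0: "u' x0 = 0"
    by (rule DERIV_local_max[where d = "min (x0 - l) (r - x0)"])
       (use in_x0 x0(2) in \<open>auto simp: abs_less_iff\<close>)
  obtain y where y: "y \<in> {l..r}" "\<And>x. x \<in> {l..r} \<Longrightarrow> w y \<le> w x"
    using continuous_attains_inf[of "{l..r}" w] w \<open>l < r\<close> unfolding C1_with_deriv_on_def by auto
  let ?W = "- w y" and ?h = "(r - l) / 2" and ?k = "\<psi>1 (u x0)"
  have W: "0 < ?W" "?k < ?h * \<psi>1 ?h * ?W"
    using height_bound[OF u w ends in_x0 u'0 m, of ?W] y(2) by auto
  have k: "0 < ?k" "0 < \<psi>2 ?k"
    using m by auto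
  have "(2 / (r - l)) / \<psi>1 ?h < ?W / ?k"
  proof -
    have "0 < \<psi>1 ?h"
      using \<open>l < r\<close> by simp
    have "(2 / (r - l)) / \<psi>1 ?h = 1 / (?h * \<psi>1 ?h)"
      by simp
    also have "\<dots> < ?W / ?k"
      using W k \<open>0 < \<psi>1 ?h\<close> \<open>l < r\<close> by (subst divide_less_eq) (auto simp: field_simps)
    finally show ?thesis .
  qed
  then have "\<psi>2 ((2 / (r - l)) / \<psi>1 ?h) < \<psi>2 (?W / ?k)"
    using psi2.increasing by (simp add: strict_mono_less)
  also have "\<dots> \<le> \<psi>2 ?W / \<psi>2 ?k"
    using supermult[of "?W / ?k" ?k] W(1) k by (simp add: pos_le_divide_eq divide_nonpos_pos)
  finally have "ennreal (\<psi>2 ((2 / (r - l)) / \<psi>1 ?h)) < ennreal (\<psi>2 ?W / \<psi>2 ?k)"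
    using W(1) k by (intro ennreal_lessI divide_pos_pos) simp_all
  also have "\<dots> \<le> split_integral q \<Phi> u l r d"
  proof -
    have "0 \<le> u x" if "x \<in> {l..r}" for x
      using pos[of x] ends that by (cases "x = l \<or> x = r") (auto intro: less_imp_le)
    then show ?thesis
      using split_integral_lower_bound[OF z eqn d y(1) _ x0(2) m] by (simp add: psi2.odd)
  qed
  finally show ?thesis .
qed

text \<open>On \<open>(l, r)\<close> the solution has one sign, and \<open>- u\<close> solves the same equation with the same split
  integral.\<close>

lemma lyapunov:
  assumes "l < r"
    and u: "C1_with_deriv_on u u' {l..r}"
    and w: "C1_with_deriv_on (\<lambda>x. \<psi>1 (u' x)) w {l..r}"
    and z: "C1_with_deriv_on (\<lambda>x. \<psi>2 (w x)) z {l..r}"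
    and eqn: "\<And>x. x \<in> {l..r} \<Longrightarrow> z x + q x * f (u x) = 0"
    and ends: "u l = 0" "u r = 0"
    and nonzero: "\<And>x. x \<in> {l<..<r} \<Longrightarrow> u x \<noteq> 0"
    and d: "d \<in> {l..r}" "w d = 0"
  shows "ennreal (\<psi>2 ((2 / (r - l)) / \<psi>1 ((r - l) / 2))) < split_integral q \<Phi> u l r d"
proof -
  have "continuous_on {l<..<r} u"
    using C1_with_deriv_on_continuous[OF u] by (rule continuous_on_subset) auto
  then have "connected (u ` {l<..<r})"
    by (intro connected_continuous_image) auto
  moreover have "0 \<notin> u ` {l<..<r}"
    using nonzero by auto
  ultimately have "\<not> (u x < 0 \<and> 0 < u y)" if "x \<in> {l<..<r}" "y \<in> {l<..<r}" for x y
    using that connectedD_interval[of "u ` {l<..<r}" "u x" "u y" 0] by force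
  then consider "\<And>x. x \<in> {l<..<r} \<Longrightarrow> 0 < u x" | "\<And>x. x \<in> {l<..<r} \<Longrightarrow> u x < 0"
    using nonzero by (meson linorder_neqE)
  then show ?thesis
  proof cases
    case 1
    show ?thesis
      by (rule lyapunov_positive[OF \<open>l < r\<close> u w z eqn ends 1 d])
  next
    case 2
    have "ennreal (\<psi>2 ((2 / (r - l)) / \<psi>1 ((r - l) / 2))) < split_integral q \<Phi> (\<lambda>x. - u x) l r d"
    proof (rule lyapunov_positive[OF \<open>l < r\<close>])
      show "C1_with_deriv_on (\<lambda>x. - u x) (\<lambda>x. - u' x) {l..r}"
        using u by (rule C1_with_deriv_on_uminus)
      show "C1_with_deriv_on (\<lambda>x. \<psi>1 (- u' x)) (\<lambda>x. - w x) {l..r}"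
        using C1_with_deriv_on_uminus[OF w] by (simp add: psi1.odd)
      show "C1_with_deriv_on (\<lambda>x. \<psi>2 (- w x)) (\<lambda>x. - z x) {l..r}"
        using C1_with_deriv_on_uminus[OF z] by (simp add: psi2.odd)
      show "- z x + q x * f (- u x) = 0" if "x \<in> {l..r}" for x
        using eqn[OF that] by (simp add: f_odd)
    qed (use ends 2 d in auto)
    then show ?thesis
      by (simp add: split_integral_minus)
  qed
qed

end

theorem theorem2p2:
  fixes a b c :: real and \<psi>1 \<psi>2 f q u :: "real \<Rightarrow> real"
  assumes "a < b" and "b < c"
    and psi1_odd: "\<And>x. \<psi>1 (- x) = - \<psi>1 x"
    and psi1_mono: "strict_mono \<psi>1"
    and psi2_odd: "\<And>x. \<psi>2 (- x) = - \<psi>2 x"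
    and psi2_mono: "strict_mono \<psi>2"
    and psi1_submult: "\<And>x y. 0 \<le> x \<Longrightarrow> 0 \<le> y \<Longrightarrow> \<psi>1 (x * y) \<le> \<psi>1 x * \<psi>1 y"
    and psi1_convex: "convex_on {0<..} (\<lambda>s. 1 / \<psi>1 s)"
    and psi2_supermult: "\<And>x y. 0 \<le> x \<Longrightarrow> 0 \<le> y \<Longrightarrow> \<psi>2 (x * y) \<ge> \<psi>2 x * \<psi>2 y"
    and q_cont: "continuous_on {a..c} q"
    and f_odd: "\<And>s. f (- s) = - f s"
    and f_cont: "continuous_on UNIV f"
    and f_sign: "\<And>s. s \<noteq> 0 \<Longrightarrow> s * f s > 0"
    and sol: "is_solution_on \<psi>1 \<psi>2 q f {a..c} u"
    and nontrivial: "\<exists>x\<in>{a..c}. u x \<noteq> 0"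
    and "u a = 0" and "u b = 0" and "u c = 0"
    and nonzero: "\<And>x. x \<in> {a<..<b} \<union> {b<..<c} \<Longrightarrow> u x \<noteq> 0"
  shows "\<exists>M\<^sub>1 M\<^sub>2 M.
     is_maximum_on (split_integral q (Phi \<psi>1 \<psi>2 f) u a b) {a..b} M\<^sub>1 \<and>
     is_maximum_on (split_integral q (Phi \<psi>1 \<psi>2 f) u b c) {b..c} M\<^sub>2 \<and>
     is_maximum_on (split_integral q (Phi \<psi>1 \<psi>2 f) u a c) {a..c} M \<and>
     (M\<^sub>1 > ennreal (\<psi>2 ((2 / (b - a)) / \<psi>1 ((b - a) / 2))) \<or>
      M\<^sub>2 > ennreal (\<psi>2 ((2 / (c - b)) / \<psi>1 ((c - b) / 2)))) \<and>
     M > ennreal (\<psi>2 ((2 / (c - a)) / \<psi>1 ((c - a) / 2)))"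
proof -
  interpret half_linear_data \<psi>1 \<psi>2 f
    by unfold_locales
      (use psi1_odd psi1_mono psi2_odd psi2_mono psi1_submult psi2_supermult f_odd f_cont f_sign in auto)
  obtain u' w z where u: "C1_with_deriv_on u u' {a..c}"
    and w: "C1_with_deriv_on (\<lambda>x. \<psi>1 (u' x)) w {a..c}"
    and z: "C1_with_deriv_on (\<lambda>x. \<psi>2 (w x)) z {a..c}"
    and eqn: "\<And>x. x \<in> {a..c} \<Longrightarrow> z x + q x * f (u x) = 0"
    using sol unfolding is_solution_on_def by auto
  note abc = \<open>a < b\<close> \<open>b < c\<close> and zeros = \<open>u a = 0\<close> \<open>u b = 0\<close> \<open>u c = 0\<close>
  obtain \<alpha> where \<alpha>: "a < \<alpha>" "\<alpha> < b" "u' \<alpha> = 0"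
    using C1_with_deriv_on_mvt[OF u, of a b] abc zeros by auto
  obtain \<beta> where \<beta>: "b < \<beta>" "\<beta> < c" "u' \<beta> = 0"
    using C1_with_deriv_on_mvt[OF u, of b c] abc zeros by auto
  obtain d where d: "\<alpha> < d" "d < \<beta>" "w d = 0"
    using C1_with_deriv_on_mvt[OF w, of \<alpha> \<beta>] \<alpha> \<beta> by auto
  have u_cont: "continuous_on {a..c} u"
    using u by (rule C1_with_deriv_on_continuous)
  have max: "\<exists>M. is_maximum_on (split_integral q \<Phi> u l r) {l..r} M"
    if "a \<le> l" "l \<le> r" "r \<le> c" for l r
    using that q_cont u_cont
    by (intro split_integral_attains_maximum) (auto intro: continuous_on_subset)
  obtain M1 where M1: "is_maximum_on (split_integral q \<Phi> u a b) {a..b} M1"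
    using max[of a b] abc by auto
  obtain M2 where M2: "is_maximum_on (split_integral q \<Phi> u b c) {b..c} M2"
    using max[of b c] abc by auto
  obtain M where M: "is_maximum_on (split_integral q \<Phi> u a c) {a..c} M"
    using max[of a c] abc by auto
  \<comment> \<open>Used with \<open>[l, r] = [a, b]\<close> or \<open>[b, c]\<close>, according to the position of \<open>d\<close>.\<close>
  have core: "ennreal (\<psi>2 ((2 / (r - l)) / \<psi>1 ((r - l) / 2))) < split_integral q \<Phi> u l r d"
      "ennreal (\<psi>2 ((2 / (c - a)) / \<psi>1 ((c - a) / 2))) < M"
    if lr: "l < r" "a \<le> l" "r \<le> c" "u l = 0" "u r = 0" "{l<..<r} \<subseteq> {a<..<b} \<union> {b<..<c}" "d \<in> {l..r}"
    for l r
  proof -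
    have sub: "{l..r} \<subseteq> {a..c}"
      using lr by auto
    show *: "ennreal (\<psi>2 ((2 / (r - l)) / \<psi>1 ((r - l) / 2))) < split_integral q \<Phi> u l r d"
      by (rule lyapunov[OF \<open>l < r\<close> u[THEN C1_with_deriv_on_subset] w[THEN C1_with_deriv_on_subset]
              z[THEN C1_with_deriv_on_subset]])
         (use sub lr nonzero d eqn in auto)
    have "ennreal (\<psi>2 ((2 / (c - a)) / \<psi>1 ((c - a) / 2)))
        \<le> ennreal (\<psi>2 ((2 / (r - l)) / \<psi>1 ((r - l) / 2)))"
      using lr by (intro ennreal_leI threshold_antimono) auto
    also note *
    also have "split_integral q \<Phi> u l r d \<le> split_integral q \<Phi> u a c d"
      using lr by (intro split_integral_mono)
    also have "\<dots> \<le> M"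
      using M d \<alpha> \<beta> unfolding is_maximum_on_def by auto
    finally show "ennreal (\<psi>2 ((2 / (c - a)) / \<psi>1 ((c - a) / 2))) < M" .
  qed
  have "(ennreal (\<psi>2 ((2 / (b - a)) / \<psi>1 ((b - a) / 2))) < M1 \<or>
      ennreal (\<psi>2 ((2 / (c - b)) / \<psi>1 ((c - b) / 2))) < M2) \<and>
      ennreal (\<psi>2 ((2 / (c - a)) / \<psi>1 ((c - a) / 2))) < M"
  proof (cases "d \<le> b")
    case True
    then have "d \<in> {a..b}"
      using d \<alpha> by simp
    moreover from this have "split_integral q \<Phi> u a b d \<le> M1"
      using M1 unfolding is_maximum_on_def by blast
    ultimately show ?thesis
      using core[of a b] abc zeros by (auto intro: order.strict_trans2)
  next
    case False
    then have "d \<in> {b..c}"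
      using d \<beta> by simp
    moreover from this have "split_integral q \<Phi> u b c d \<le> M2"
      using M2 unfolding is_maximum_on_def by blast
    ultimately show ?thesis
      using core[of b c] abc zeros by (auto intro: order.strict_trans2)
  qed
  with M1 M2 M show ?thesis
    by blast
qed

end
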